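(* Let $G$ be a finite solvable group and let $H, K \leq G$ be isomorphic subgroups, with $H$ a maximal subgroup of $G$. Let $p$ be the prime such that $|G:H| = p^n$ for some positive integer $n$. If $l_p(G) \leq 1$, then $K$ is also a maximal subgroup of $G$.
   Context: Recall that a maximal subgroup of a finite solvable group has prime power index. For a finite $p$-soluble group $G$, the $p$-length $l_p(G)$ is the number of (nontrivial) factors that are $p$-groups in the lower $p$-series $$1 \leq O_{p'}(G) \leq O_{p',p}(G) \leq O_{p',p,p'}(G) \leq \cdots \leq G,$$ where $O_{p'}(G)$ is the largest normal subgroup of $G$ of order prime to $p$, $O_{p',p}(G)/O_{p'}(G)$ is the largest normal $p$-subgroup of $G/O_{p'}(G)$, $O_{p',p,p'}(G)/O_{p',p}(G)$ is the largest normal $p'$-subgroup of $G/O_{p',p}(G)$, and so on. *)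

theory Defs
  imports "HOL-Algebra.Solvable_Groups" "HOL-Algebra.SndIsomorphismGrp" "HOL-Computational_Algebra.Primes"
begin

definition maximal_subgroup :: "'a set \<Rightarrow> ('a, 'b) monoid_scheme \<Rightarrow> bool"
  where "maximal_subgroup H G \<longleftrightarrow>
    subgroup H G \<and> H \<noteq> carrier G \<and>
    (\<forall>J. subgroup J G \<and> H \<subseteq> J \<longrightarrow> J = H \<or> J = carrier G)"

text \<open>Both cores are greatest elements with respect to inclusion. They exist in every finite
  group, because a product of two normal subgroups of order prime to \<open>p\<close> (of \<open>p\<close>-power order)
  is again one.\<close>

definition pprime_core :: "nat \<Rightarrow> ('a, 'b) monoid_scheme \<Rightarrow> 'a set"
  where "pprime_core p G = (GREATEST N. N \<lhd> G \<and> coprime p (card N))"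

definition p_core :: "nat \<Rightarrow> ('a, 'b) monoid_scheme \<Rightarrow> 'a set"
  where "p_core p G = (GREATEST N. N \<lhd> G \<and> (\<exists>k. card N = p ^ k))"

lemma card_set_mult_dvd:
  assumes "A \<lhd> G" and "B \<lhd> G" and "finite (carrier G)"
  shows "card (A <#>\<^bsub>G\<^esub> B) dvd card A * card B"
proof -
  interpret A: normal A G by fact
  have B: "subgroup B G" using assms(2) normal_imp_subgroup by blast
  interpret second_isomorphism_grp A G B
    using B by (intro second_isomorphism_grp.intro second_isomorphism_grp_axioms.intro A.normal_axioms)
  have AB: "subgroup (A <#>\<^bsub>G\<^esub> B) G" by (rule normal_set_mult_subgroup)
  let ?GB = "G\<lparr>carrier := B\<rparr>" and ?GAB = "G\<lparr>carrier := A <#>\<^bsub>G\<^esub> B\<rparr>"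
  interpret GB: group ?GB using B A.subgroup_imp_group by blast
  interpret GAB: group ?GAB using AB A.subgroup_imp_group by blast
  have "?GB Mod (A \<inter> B) \<cong> ?GAB Mod A"
    by (rule is_isoI[OF normal_intersection_quotient_isom])
  then have eq: "card (rcosets\<^bsub>?GB\<^esub> (A \<inter> B)) = card (rcosets\<^bsub>?GAB\<^esub> A)"
    using iso_same_card[of "?GB Mod (A \<inter> B)" "?GAB Mod A"] by (simp add: FactGroup_def)
  have "subgroup (A \<inter> B) ?GB"
    using normal_imp_subgroup[OF normal_subgrp_intersection_normal] by (simp add: Int_commute)
  from GB.lagrange[OF this]
  have "card B = card (rcosets\<^bsub>?GB\<^esub> (A \<inter> B)) * card (A \<inter> B)"
    by (simp add: order_def)
  then have "card (rcosets\<^bsub>?GB\<^esub> (A \<inter> B)) dvd card B" by (rule dvdI)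
  moreover have "subgroup A ?GAB"
    using A.subgroup_incl[OF A.is_subgroup AB H_contained_in_set_mult] .
  from GAB.lagrange[OF this]
  have "card (rcosets\<^bsub>?GAB\<^esub> A) * card A = card (A <#>\<^bsub>G\<^esub> B)"
    by (simp add: order_def)
  ultimately show ?thesis
    using eq mult_dvd_mono[of "card (rcosets\<^bsub>?GB\<^esub> (A \<inter> B))" "card B" "card A" "card A"]
    by (simp add: mult.commute[of "card A" "card B"])
qed

lemma greatest_normal_subgroup:
  assumes "group G" and fin: "finite (carrier G)" and one: "P 1"
    and mult: "\<And>a b c. P a \<Longrightarrow> P b \<Longrightarrow> c dvd a * b \<Longrightarrow> P (c::nat)"
  defines "N \<equiv> (GREATEST N. N \<lhd> G \<and> P (card N))"
  shows "N \<lhd> G \<and> P (card N)" and "M \<lhd> G \<Longrightarrow> P (card M) \<Longrightarrow> M \<subseteq> N"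
proof -
  interpret group G by fact
  let ?Q = "\<lambda>N. N \<lhd> G \<and> P (card N)"
  have sub: "X \<subseteq> carrier G" if "X \<lhd> G" for X
    using that normal_imp_subgroup subgroup.subset by blast
  have "?Q {\<one>\<^bsub>G\<^esub>}" using one one_is_normal by simp
  moreover have "\<forall>X. ?Q X \<longrightarrow> card X < Suc (card (carrier G))"
    using sub fin by (simp add: card_mono less_Suc_eq_le)
  ultimately obtain X where X: "?Q X" and max: "\<And>Y. ?Q Y \<Longrightarrow> card Y \<le> card X"
    using ex_has_greatest_nat[of ?Q "{\<one>\<^bsub>G\<^esub>}" card "Suc (card (carrier G))"]
    by (auto simp: less_imp_le)
  have greatest: "Y \<subseteq> X" if Y: "?Q Y" for Y
  proof -
    have *: "X <#>\<^bsub>G\<^esub> Y \<lhd> G" using normal_subgroup_set_mult_closed X Y by blast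
    have "P (card (X <#>\<^bsub>G\<^esub> Y))"
      using mult[OF _ _ card_set_mult_dvd] X Y fin by blast
    then have "card (X <#>\<^bsub>G\<^esub> Y) \<le> card X" using max * by blast
    moreover interpret second_isomorphism_grp X G Y
      using X normal_imp_subgroup[of Y G] Y
      by (intro second_isomorphism_grp.intro second_isomorphism_grp_axioms.intro) auto
    have "X \<subseteq> X <#>\<^bsub>G\<^esub> Y" "Y \<subseteq> X <#>\<^bsub>G\<^esub> Y"
      using H_contained_in_set_mult S_contained_in_set_mult by auto
    moreover have "finite (X <#>\<^bsub>G\<^esub> Y)" using sub[OF *] fin finite_subset by blast
    ultimately show ?thesis using card_seteq[of "X <#>\<^bsub>G\<^esub> Y" X] by auto
  qed
  have "N = X" unfolding N_def using X greatest by (intro Greatest_equality) auto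
  then show "?Q N" and "M \<lhd> G \<Longrightarrow> P (card M) \<Longrightarrow> M \<subseteq> N" using X greatest by auto
qed

lemma pprime_core:
  assumes "group G" and "finite (carrier G)"
  shows "pprime_core p G \<lhd> G" and "coprime p (card (pprime_core p G))"
    and "M \<lhd> G \<Longrightarrow> coprime p (card M) \<Longrightarrow> M \<subseteq> pprime_core p G"
proof -
  have mult: "coprime p c" if ab: "coprime p a" "coprime p b" and dvd: "c dvd a * b"
    for a b c :: nat
  proof -
    from ab have "coprime p (a * b)" by simp
    then show ?thesis by (rule coprime_divisors[OF dvd_refl dvd])
  qed
  have one: "coprime p 1" by simp
  have "pprime_core p G \<lhd> G \<and> coprime p (card (pprime_core p G))"
    unfolding pprime_core_def
    by (rule greatest_normal_subgroup(1)[where P = "coprime p", OF assms one]) (rule mult)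
  then show "pprime_core p G \<lhd> G" "coprime p (card (pprime_core p G))" by simp_all
  show "M \<subseteq> pprime_core p G" if M: "M \<lhd> G" "coprime p (card M)"
    unfolding pprime_core_def
    by (rule greatest_normal_subgroup(2)[where P = "coprime p", OF assms one _ M]) (rule mult)
qed

lemma p_core:
  assumes "group G" and "finite (carrier G)" and "Factorial_Ring.prime p"
  shows "p_core p G \<lhd> G" and "\<exists>k. card (p_core p G) = p ^ k"
    and "M \<lhd> G \<Longrightarrow> card M = p ^ k \<Longrightarrow> M \<subseteq> p_core p G"
proof -
  let ?P = "\<lambda>c. \<exists>k. c = p ^ k"
  have mult: "?P c" if ab: "?P a" "?P b" and dvd: "c dvd a * b" for a b c :: nat
  proof -
    from ab obtain k l where "a * b = p ^ (k + l)" by (auto simp: power_add)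
    then show ?thesis using dvd divides_primepow_nat[OF assms(3)] by metis
  qed
  have one: "?P 1" by (metis power_0)
  have "p_core p G \<lhd> G \<and> ?P (card (p_core p G))"
    unfolding p_core_def
    by (rule greatest_normal_subgroup(1)[where P = ?P, OF assms(1,2) one]) (rule mult)
  then show "p_core p G \<lhd> G" "\<exists>k. card (p_core p G) = p ^ k" by simp_all
  show "M \<subseteq> p_core p G" if M: "M \<lhd> G" "card M = p ^ k"
    unfolding p_core_def
  proof (rule greatest_normal_subgroup(2)[where P = ?P, OF assms(1,2) one])
    show "?P (card M)" using M by blast
  qed (erule (2) mult, rule M)
qed

text \<open>The terms are \<open>1\<close>, \<open>O\<^bsub>p'\<^esub>(G)\<close>, \<open>O\<^bsub>p',p\<^esub>(G)\<close>, \<open>O\<^bsub>p',p,p'\<^esub>(G)\<close>, and so on, so the step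
  from index \<open>i\<close> to \<open>Suc i\<close> is a \<open>p'\<close>-step for even \<open>i\<close> and a \<open>p\<close>-step for odd \<open>i\<close>.
  Each term is the preimage in \<open>G\<close> of a core of the quotient by the previous term.\<close>

fun lower_p_series :: "nat \<Rightarrow> ('a, 'b) monoid_scheme \<Rightarrow> nat \<Rightarrow> 'a set"
  where
    "lower_p_series p G 0 = {\<one>\<^bsub>G\<^esub>}"
  | "lower_p_series p G (Suc i) =
       (let N = lower_p_series p G i in
        {x \<in> carrier G. N #>\<^bsub>G\<^esub> x \<in>
           (if even i then pprime_core p (G Mod N) else p_core p (G Mod N))})"

text \<open>The series is indexed by all natural numbers. In a finite \<open>p\<close>-soluble group it is
  eventually constant with value \<open>G\<close>, so only finitely many steps are counted.\<close>

definition p_length :: "nat \<Rightarrow> ('a, 'b) monoid_scheme \<Rightarrow> nat"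
  where "p_length p G =
    card {i. odd i \<and> lower_p_series p G i \<noteq> lower_p_series p G (Suc i)}"

end

theory Submission
  imports Defs "HOL-Algebra.Sylow" "HOL-Algebra.Group_Action" "HOL-Algebra.Multiplicative_Group"
begin

text \<open>Since \<open>l\<^sub>p(G) \<le> 1\<close>, there are normal subgroups \<open>M \<subseteq> T\<close> of \<open>G\<close> such that \<open>M\<close> and \<open>G/T\<close>
  have order prime to \<open>p\<close> and \<open>T/M\<close> is a \<open>p\<close>-group. The subgroup \<open>K\<close> has the same order as \<open>H\<close>,
  so its index is \<open>p\<^sup>n\<close> too and \<open>G = TK\<close>.

  Fix a chief series of \<open>G\<close> and call a factor \<open>B/A\<close> of it a \<open>p\<close>-factor if \<open>p\<close> divides its order.
  Such a factor is centralized by \<open>T\<close> (\<open>chief_factor_centralized\<close>): \<open>M\<close> acts trivially on it for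
  reasons of order, and the \<open>p\<close>-group \<open>T/M\<close> has a nontrivial fixed point. So whenever a subgroup
  \<open>S\<close> is normalized by \<open>K\<close>, the subgroup \<open>A(S \<inter> B)\<close> is normalized by \<open>TK = G\<close>, that is, \<open>S\<close>
  covers or avoids every \<open>p\<close>-factor (\<open>chief_factor_cover_or_avoid\<close>). The \<open>p\<close>-part of the order of
  \<open>S\<close> is then the product of the \<open>p\<close>-parts of the factors that \<open>S\<close> covers. In a chain of such
  subgroups the number of covered factors increases at every step at which the \<open>p\<close>-part of the order
  does (\<open>card_covered_less\<close>).

  Let \<open>m\<close> be the number of \<open>p\<close>-factors, and let \<open>N\<^sub>i\<close> be the terms of the chief series. By
  maximality \<open>H N\<^sub>i\<close> is \<open>H\<close> or \<open>G\<close>, so the \<open>p\<close>-part of the order of \<open>H \<inter> N\<^sub>i\<close> grows in at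
  least \<open>m - 1\<close> places (\<open>card_covered_maximal_subgroup\<close>). The isomorphism carries this chain to a
  chain of normal subgroups of \<open>K\<close>, whence \<open>K\<close> covers at least \<open>m - 1\<close> factors
  (\<open>card_covered_iso\<close>). If there were a subgroup \<open>J\<close> strictly between \<open>K\<close> and \<open>G\<close>, then \<open>J\<close>
  would cover at least \<open>m\<close> and \<open>G\<close> at least \<open>m + 1\<close> factors, which is absurd.\<close>

section \<open>Orders of subgroups and products\<close>

lemma (in group) card_subgroup_dvd:
  assumes "subgroup A G" "subgroup B G" "A \<subseteq> B"
  shows "card A dvd card B"
proof -
  have "subgroup A (G\<lparr>carrier := B\<rparr>)" using assms by (simp add: subgroup_incl)
  from group.lagrange[OF subgroup_imp_group[OF assms(2)] this]
  have "card (rcosets\<^bsub>G\<lparr>carrier := B\<rparr>\<^esub> A) * card A = card B" by (simp add: order_def)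
  from this[symmetric] show ?thesis using dvd_triv_right[of "card A"] by simp
qed

context group
begin

lemma subgroup_set_mult:
  assumes "A \<lhd> G" "subgroup S G"
  shows "subgroup (A <#> S) G" "A \<subseteq> A <#> S" "S \<subseteq> A <#> S"
proof -
  interpret second_isomorphism_grp A G S
    using assms by (intro second_isomorphism_grp.intro second_isomorphism_grp_axioms.intro)
  show "subgroup (A <#> S) G" "A \<subseteq> A <#> S" "S \<subseteq> A <#> S"
    using normal_set_mult_subgroup H_contained_in_set_mult S_contained_in_set_mult by auto
qed

lemma set_mult_subset:
  assumes "subgroup B G" "A \<subseteq> B" "S \<subseteq> B"
  shows "A <#> S \<subseteq> B"
  using assms subgroup.m_closed[OF assms(1)] by (auto simp: set_mult_def)

lemma card_set_mult:
  assumes "A \<lhd> G" "subgroup S G"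
  shows "card (A <#> S) * card (A \<inter> S) = card A * card S"
proof -
  interpret A: normal A G by fact
  interpret second_isomorphism_grp A G S
    using assms(2) by (intro second_isomorphism_grp.intro second_isomorphism_grp_axioms.intro A.normal_axioms)
  have AS: "subgroup (A <#> S) G" by (rule normal_set_mult_subgroup)
  let ?GS = "G\<lparr>carrier := S\<rparr>" and ?GAS = "G\<lparr>carrier := A <#> S\<rparr>"
  interpret GS: group ?GS using assms(2) subgroup_imp_group by blast
  interpret GAS: group ?GAS using AS subgroup_imp_group by blast
  have "?GS Mod (A \<inter> S) \<cong> ?GAS Mod A"
    by (rule is_isoI[OF normal_intersection_quotient_isom])
  then have eq: "card (rcosets\<^bsub>?GS\<^esub> (A \<inter> S)) = card (rcosets\<^bsub>?GAS\<^esub> A)"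
    using iso_same_card[of "?GS Mod (A \<inter> S)" "?GAS Mod A"] by (simp add: FactGroup_def)
  have "subgroup (A \<inter> S) ?GS"
    using normal_imp_subgroup[OF normal_subgrp_intersection_normal] by (simp add: Int_commute)
  from GS.lagrange[OF this]
  have S: "card S = card (rcosets\<^bsub>?GS\<^esub> (A \<inter> S)) * card (A \<inter> S)"
    by (simp add: order_def)
  have "subgroup A ?GAS"
    using subgroup_incl[OF A.is_subgroup AS H_contained_in_set_mult] .
  from GAS.lagrange[OF this]
  have "card (rcosets\<^bsub>?GAS\<^esub> A) * card A = card (A <#> S)"
    by (simp add: order_def)
  with S eq show ?thesis by (metis mult.assoc mult.commute)
qed

end

section \<open>Fixed points of group actions\<close>

text \<open>The acting group acts through a \<open>p\<close>-group, so the orbits have \<open>p\<close>-power length and the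
  number of fixed points is congruent to \<open>card E\<close> modulo \<open>p\<close>. Hence one fixed point forces
  another. The lemma speaks of a subgroup \<open>M\<close> that acts trivially instead of a quotient, because
  it is applied to an extension of a \<open>p'\<close>-group by a \<open>p\<close>-group.\<close>

lemma (in group_action) p_power_orbits_imp_second_fixed_point:
  assumes finE: "finite E" and p: "Factorial_Ring.prime p" and "p dvd card E"
    and x0: "x0 \<in> E" "\<And>g. g \<in> carrier G \<Longrightarrow> \<phi> g x0 = x0"
    and M: "subgroup M G" "\<And>g x. g \<in> M \<Longrightarrow> x \<in> E \<Longrightarrow> \<phi> g x = x"
    and order: "order G = card M * p ^ k" and finG: "finite (carrier G)"
  shows "\<exists>x\<in>E. x \<noteq> x0 \<and> (\<forall>g\<in>carrier G. \<phi> g x = x)"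
proof (rule ccontr)
  assume none: "\<not> ?thesis"
  interpret group G using group_hom group_hom.axioms(1) by auto
  have orb0: "orbit G \<phi> x0 = {x0}"
    using x0 one_closed by (auto simp: orbit_def intro!: exI[of _ \<one>])
  have in_E: "orb \<subseteq> E" if "orb \<in> orbits G E \<phi>" for orb
    using orbits_coverture that by blast
  have dvd: "p dvd card orb" if orb: "orb \<in> orbits G E \<phi>" "orb \<noteq> {x0}" for orb
  proof -
    obtain x where x: "x \<in> E" "orb = orbit G \<phi> x" using orb(1) by (auto simp: orbits_def)
    then have "x \<noteq> x0" using orb(2) orb0 by auto
    then obtain g where g: "g \<in> carrier G" "\<phi> g x \<noteq> x" using none x(1) by blast
    have "x \<in> orb" "\<phi> g x \<in> orb"
      using x g orbit_refl by (auto simp: orbit_def)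
    moreover have "finite orb" using in_E[OF orb(1)] finE finite_subset by blast
    ultimately have ne: "card orb \<noteq> 1" using g(2) by (auto simp: card_1_singleton_iff)
    let ?S = "stabilizer G \<phi> x"
    have S: "subgroup ?S G" using stabilizer_subgroup x by blast
    have "M \<subseteq> ?S" using M x subgroup.subset[OF M(1)] by (auto simp: stabilizer_def)
    then have "card M dvd card ?S" by (rule card_subgroup_dvd[OF M(1) S])
    then obtain c where c: "card ?S = card M * c" by blast
    have "card orb * card ?S = order G"
      using orbit_stabilizer_theorem[OF x(1)] x(2) by simp
    moreover have "card M > 0"
      using M(1) finG by (metis subgroup.finite_imp_card_positive)
    ultimately have "card orb * c = p ^ k" using order c by (simp add: algebra_simps)
    then have "card orb dvd p ^ k" by (metis dvd_triv_left)
    then obtain j where "card orb = p ^ j" using divides_primepow_nat[OF p] by blast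
    with ne show ?thesis by (cases j) auto
  qed
  have fin: "finite (orbits G E \<phi>)"
    using finE orbits_coverture by (metis finite_UnionD)
  have in0: "{x0} \<in> orbits G E \<phi>" using orb0 x0(1) by (auto simp: orbits_def)
  have "card E = (\<Sum>orb\<in>orbits G E \<phi>. card orb)"
    using disjoint_sum[OF finE, of "\<lambda>_. 1::nat"] by simp
  also have "\<dots> = 1 + (\<Sum>orb\<in>orbits G E \<phi> - {{x0}}. card orb)"
    using sum.remove[OF fin in0, of card] by simp
  finally have "card E = 1 + (\<Sum>orb\<in>orbits G E \<phi> - {{x0}}. card orb)" .
  moreover have "p dvd (\<Sum>orb\<in>orbits G E \<phi> - {{x0}}. card orb)"
    using dvd by (intro dvd_sum) auto
  ultimately have "p dvd 1" using \<open>p dvd card E\<close> by (metis dvd_add_left_iff)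
  then show False using p by auto
qed

section \<open>Normal subgroups of solvable groups\<close>

context group
begin

text \<open>A weak form of Cauchy's theorem: a subgroup of order \<open>q\<close> is a nontrivial \<open>q\<close>-torsion group,
  and Sylow's theorem supplies one.\<close>

lemma exists_prime_power_torsion:
  assumes Y: "subgroup Y G" "finite Y" and q: "Factorial_Ring.prime q" "q dvd card Y"
  shows "\<exists>x\<in>Y. x \<noteq> \<one> \<and> (\<exists>b. x [^] (q ^ b) = \<one>)"
proof -
  let ?Y = "G\<lparr>carrier := Y\<rparr>"
  interpret Y: group ?Y using Y subgroup_imp_group by blast
  obtain m where "order ?Y = q ^ 1 * m" using q(2) by (auto simp: order_def)
  from sylow_thm[OF q(1) Y.is_group this]
  obtain S where S: "subgroup S ?Y" "card S = q" using Y(2) by auto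
  then have "S \<noteq> {\<one>}" using q(1) not_prime_1 by auto
  moreover have "\<one> \<in> S" using subgroup.one_closed[OF S(1)] by simp
  ultimately obtain x where x: "x \<in> S" "x \<noteq> \<one>" by blast
  have S': "subgroup S G" using S(1) Y(1) incl_subgroup by blast
  let ?S = "G\<lparr>carrier := S\<rparr>"
  interpret S: group ?S using S' subgroup_imp_group by blast
  have "x [^]\<^bsub>?S\<^esub> card S = \<one>"
    using S.pow_order_eq_1[of x] x by (simp add: order_def)
  then have "x [^] (q ^ 1) = \<one>" using S(2) nat_pow_consistent[of x q S] by simp
  moreover have "x \<in> Y" using subgroup.subset[OF S(1)] x by auto
  ultimately show ?thesis using x by blast
qed

lemma normal_p_torsion:
  fixes p :: nat
  assumes D: "D \<lhd> G" and comm: "\<And>x y. x \<in> D \<Longrightarrow> y \<in> D \<Longrightarrow> x \<otimes> y = y \<otimes> x"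
  shows "{x \<in> D. \<exists>e::nat. x [^] (p ^ e) = \<one>} \<lhd> G" (is "?Y \<lhd> G")
proof -
  interpret D: normal D G by fact
  have lift: "x [^] (p ^ (e + f)) = \<one>" if "x \<in> D" "x [^] (p ^ e) = \<one>" for x and e f :: nat
    using that D.mem_carrier nat_pow_pow[of x "p ^ e" "p ^ f"] by (simp add: power_add)
  show ?thesis unfolding normal_inv_iff
  proof (intro conjI ballI)
    show "subgroup ?Y G"
    proof (rule subgroupI)
      show "?Y \<noteq> {}" using D.one_closed by (auto intro!: exI[of _ \<one>])
      show "inv x \<in> ?Y" if "x \<in> ?Y" for x
        using that D.mem_carrier by (auto simp: nat_pow_inv)
      show "x \<otimes> y \<in> ?Y" if xy: "x \<in> ?Y" "y \<in> ?Y" for x y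
      proof -
        obtain e f where "x [^] (p ^ e) = \<one>" "y [^] (p ^ f) = \<one>" using xy by blast
        then have "x [^] (p ^ (e + f)) = \<one>" "y [^] (p ^ (e + f)) = \<one>"
          using lift[of x e f] lift[of y f e] xy by (auto simp: add.commute)
        then have "(x \<otimes> y) [^] (p ^ (e + f)) = \<one>"
          using pow_mult_distrib[OF comm[of x y]] xy D.mem_carrier by simp
        then show ?thesis using xy by auto
      qed
    qed (use D.subset in auto)
    fix g x assume g: "g \<in> carrier G" and x: "x \<in> ?Y"
    have xG: "x \<in> carrier G" using x D.mem_carrier by auto
    have "(g \<otimes> x \<otimes> inv g) [^] n = g \<otimes> x [^] n \<otimes> inv g" for n :: nat
    proof (induction n)
      case (Suc n)
      have "inv g \<otimes> (g \<otimes> (x \<otimes> inv g)) = x \<otimes> inv g"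
        using g xG m_assoc[of "inv g" g "x \<otimes> inv g", symmetric] by simp
      then show ?case using Suc g xG by (simp add: m_assoc)
    qed (use g in auto)
    moreover obtain e where "x [^] (p ^ e) = \<one>" using x by blast
    ultimately have "(g \<otimes> x \<otimes> inv g) [^] (p ^ e) = \<one>" using g by simp
    then show "g \<otimes> x \<otimes> inv g \<in> ?Y" using x g D.inv_op_closed2 by blast
  qed
qed

text \<open>The last nontrivial term \<open>D\<close> of the derived series is normal and abelian. If \<open>p\<close> divides
  its order, its \<open>p\<close>-torsion is nontrivial and, being characteristic in \<open>D\<close>, normal in \<open>G\<close>;
  otherwise \<open>D\<close> itself has order prime to \<open>p\<close>. Solvability enters the proof here: it keeps
  the lower \<open>p\<close>-series growing until it reaches \<open>G\<close>.\<close>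

lemma solvable_imp_normal_p_or_pprime:
  assumes fin: "finite (carrier G)" and "solvable G" and "carrier G \<noteq> {\<one>}"
    and p: "Factorial_Ring.prime p"
  shows "\<exists>Y. Y \<lhd> G \<and> Y \<noteq> {\<one>} \<and> ((\<exists>k. card Y = p ^ k) \<or> coprime p (card Y))"
proof -
  let ?d = "\<lambda>n. (derived G ^^ n) (carrier G)"
  have ex: "\<exists>n. ?d n = {\<one>}" using assms(2) solvable_iff_trivial_derived_seq by blast
  define n where "n = (LEAST n. ?d n = {\<one>})"
  have n: "?d n = {\<one>}" "n \<noteq> 0"
    using LeastI_ex[OF ex] assms(3) unfolding n_def by (simp, metis funpow_0)
  then obtain m where m: "n = Suc m" by (cases n) auto
  define D where "D = ?d m"
  have ne: "D \<noteq> {\<one>}" using not_less_Least[of m "\<lambda>n. ?d n = {\<one>}"] m unfolding n_def D_def by auto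
  have D: "D \<lhd> G" unfolding D_def
    by (induction m) (auto simp: normal_self derived_is_normal)
  interpret D: normal D G by fact
  have "derived G D = {\<one>}" using n m D_def by simp
  then have der: "x \<otimes> y \<otimes> inv x \<otimes> inv y = \<one>" if "x \<in> D" "y \<in> D" for x y
    using that incl[of _ "derived_set G D" G] unfolding derived_def by blast
  have comm: "x \<otimes> y = y \<otimes> x" if xy: "x \<in> D" "y \<in> D" for x y
  proof -
    have "x \<otimes> y \<otimes> inv (y \<otimes> x) = \<one>"
      using der[OF xy] xy D.mem_carrier by (simp add: m_assoc inv_mult_group)
    then have "x \<otimes> y = inv (inv (y \<otimes> x))"
      using xy D.mem_carrier by (intro inv_equality[symmetric]) auto
    then show ?thesis using xy D.mem_carrier by simp
  qed
  have finD: "finite D" using D.subset fin finite_subset by blast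
  show ?thesis
  proof (cases "p dvd card D")
    case False
    then have "coprime p (card D)" using p prime_imp_coprime by blast
    then show ?thesis using D ne by blast
  next
    case True
    define Y where "Y = {x \<in> D. \<exists>e::nat. x [^] (p ^ e) = \<one>}"
    have Y: "Y \<lhd> G" unfolding Y_def by (rule normal_p_torsion[OF D comm])
    have finY: "finite Y" using finD by (simp add: Y_def)
    have subY: "subgroup Y G" using Y normal_imp_subgroup by blast
    obtain x where "x \<in> D" "x \<noteq> \<one>" "\<exists>b. x [^] (p ^ b) = \<one>"
      using exists_prime_power_torsion[OF D.is_subgroup finD p True] by blast
    then have neY: "Y \<noteq> {\<one>}" unfolding Y_def by blast
    \<comment> \<open>An element of \<open>q\<close>-power order in \<open>Y\<close> also has \<open>p\<close>-power order.\<close>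
    have "q = p" if q: "Factorial_Ring.prime q" "q dvd card Y" for q
    proof (rule ccontr)
      assume qp: "q \<noteq> p"
      obtain x b where x: "x \<in> Y" "x \<noteq> \<one>" "x [^] (q ^ b) = \<one>"
        using exists_prime_power_torsion[OF subY finY q] by blast
      obtain e where e: "x [^] (p ^ e) = \<one>" using x by (auto simp: Y_def)
      have xG: "x \<in> carrier G" using x(1) subgroup.mem_carrier[OF subY] by blast
      have "ord x dvd q ^ b" "ord x dvd p ^ e"
        using pow_eq_id[OF xG] x(3) e by auto
      moreover have "coprime (q ^ b) (p ^ e)"
        using primes_coprime[OF q(1) p] qp by simp
      ultimately have "ord x = 1" using coprime_common_divisor_nat by blast
      then show False using x(2) xG ord_eq_1 by blast
    qed
    moreover have "card Y > 0" using finY subgroup.one_closed[OF subY] by (auto simp: card_gt_0_iff)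
    moreover obtain k m where "card Y = p ^ k * m" "\<not> p dvd m"
      using multiplicity_decompose'[of "card Y" p] p calculation(2) not_prime_unit by (metis mult.commute neq0_conv)
    moreover have "m = 1"
    proof (rule ccontr)
      assume "m \<noteq> 1"
      then obtain q where "Factorial_Ring.prime q" "q dvd m" using prime_factor_nat by blast
      then show False using calculation by (metis dvd_mult)
    qed
    ultimately have "\<exists>k. card Y = p ^ k" by auto
    then show ?thesis using Y neY by blast
  qed
qed

end

section \<open>The lower p-series in terms of normal subgroups\<close>

context normal
begin

lemma normal_preimage_coset:
  assumes "C \<lhd> G Mod H"
  shows "{x \<in> carrier G. H #> x \<in> C} \<lhd> G"
  using factgroup_subgroup_union_normal[OF assms]
    factgroup_subgroup_union_char[OF normal_imp_subgroup[OF assms]] by simp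

lemma normal_image_coset:
  assumes "Y \<lhd> G"
  shows "(#>) H ` Y \<lhd> G Mod H"
proof (rule normal.surj_hom_normal_subgroup[OF assms])
  show "group_hom G (G Mod H) ((#>) H)"
    by (simp add: group_hom_def group_hom_axioms_def is_group factorgroup_is_group r_coset_hom_Mod)
qed (simp add: carrier_FactGroup)

lemma card_coset_image:
  assumes "subgroup Y G" "H \<subseteq> Y"
  shows "card Y = card H * card ((#>) H ` Y)"
proof -
  let ?Y = "G\<lparr>carrier := Y\<rparr>"
  have "subgroup H ?Y" using assms is_subgroup by (simp add: subgroup_incl)
  from group.lagrange[OF subgroup_imp_group[OF assms(1)] this]
  have "card (rcosets\<^bsub>?Y\<^esub> H) * card H = card Y" by (simp add: order_def)
  moreover have "rcosets\<^bsub>?Y\<^esub> H = (#>) H ` Y" by (auto simp: RCOSETS_def)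
  ultimately show ?thesis by (simp add: mult.commute)
qed

lemma subset_preimage_coset:
  assumes "C \<lhd> G Mod H"
  shows "H \<subseteq> {x \<in> carrier G. H #> x \<in> C}"
proof -
  have "H \<in> C" using subgroup.one_closed[OF normal_imp_subgroup[OF assms]] by simp
  then show ?thesis using rcos_const mem_carrier by auto
qed

lemma card_preimage_coset:
  assumes C: "C \<lhd> G Mod H"
  shows "card {x \<in> carrier G. H #> x \<in> C} = card H * card C"
proof -
  have "C \<subseteq> (#>) H ` carrier G"
    using subgroup.subset[OF normal_imp_subgroup[OF C]] by (simp add: carrier_FactGroup)
  then have "(#>) H ` {x \<in> carrier G. H #> x \<in> C} = C" by auto
  then show ?thesis
    using card_coset_image[OF normal_imp_subgroup[OF normal_preimage_coset[OF C]] subset_preimage_coset[OF C]]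
    by simp
qed

end

text \<open>Unfolding the recursion equation would replace a term of the series by its description through a
  core of a quotient, which the proofs below use only once per step.\<close>

declare lower_p_series.simps(2) [simp del]

context group
begin

context
  fixes p :: nat
  assumes fin: "finite (carrier G)" and p: "Factorial_Ring.prime p"
begin

lemma finite_Mod: "finite (carrier (G Mod A))"
  using fin by (simp add: carrier_FactGroup)

lemma lower_p_series_normal: "lower_p_series p G i \<lhd> G"
proof (induction i)
  case 0
  then show ?case by (simp add: one_is_normal)
next
  case (Suc i)
  interpret N: normal "lower_p_series p G i" G by (rule Suc)
  define C where "C = (if even i then pprime_core p (G Mod lower_p_series p G i)
    else p_core p (G Mod lower_p_series p G i))"
  have C: "lower_p_series p G (Suc i) = {x \<in> carrier G. lower_p_series p G i #> x \<in> C}"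
    by (simp add: C_def Let_def lower_p_series.simps(2))
  have "C \<lhd> G Mod lower_p_series p G i"
    unfolding C_def using pprime_core(1)[OF N.factorgroup_is_group finite_Mod]
      p_core(1)[OF N.factorgroup_is_group finite_Mod p] by simp
  then show ?case using N.normal_preimage_coset C by metis
qed

text \<open>Each term of the lower \<open>p\<close>-series is described inside \<open>G\<close>, by the orders of normal subgroups,
  so that no quotient group appears any more: the step multiplies the order by a number prime to
  \<open>p\<close>, respectively a power of \<open>p\<close>, and contains every normal subgroup obtained by such a step.\<close>

lemma lower_p_series_step:
  defines "N \<equiv> lower_p_series p G"
  shows "N i \<subseteq> N (Suc i)"
    and "even i \<Longrightarrow> \<exists>c. card (N (Suc i)) = card (N i) * c \<and> coprime p c"
    and "odd i \<Longrightarrow> \<exists>k. card (N (Suc i)) = card (N i) * p ^ k"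
    and "even i \<Longrightarrow> Y \<lhd> G \<Longrightarrow> N i \<subseteq> Y \<Longrightarrow> card Y = card (N i) * c \<Longrightarrow> coprime p c \<Longrightarrow> Y \<subseteq> N (Suc i)"
    and "odd i \<Longrightarrow> Y \<lhd> G \<Longrightarrow> N i \<subseteq> Y \<Longrightarrow> card Y = card (N i) * p ^ k \<Longrightarrow> Y \<subseteq> N (Suc i)"
proof -
  interpret N: normal "N i" G unfolding N_def by (rule lower_p_series_normal)
  define C where "C = (if even i then pprime_core p (G Mod N i) else p_core p (G Mod N i))"
  have "N (Suc i) = {x \<in> carrier G. N i #> x \<in> C}"
    unfolding N_def C_def by (simp add: Let_def lower_p_series.simps(2))
  note C = this C_def
  note pp = pprime_core[OF N.factorgroup_is_group finite_Mod, where p = p]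
  note pc = p_core[OF N.factorgroup_is_group finite_Mod p]
  have Cn: "C \<lhd> G Mod N i" using C(2) pp(1) pc(1) by simp
  have card: "card (N (Suc i)) = card (N i) * card C" using N.card_preimage_coset[OF Cn] C(1) by simp
  have pos: "card (N i) > 0" by (rule N.finite_imp_card_positive[OF fin])
  show "N i \<subseteq> N (Suc i)" using N.subset_preimage_coset[OF Cn] C(1) by simp
  show "\<exists>c. card (N (Suc i)) = card (N i) * c \<and> coprime p c" if "even i"
    using card pp(2) C(2) that by auto
  show "\<exists>k. card (N (Suc i)) = card (N i) * p ^ k" if "odd i"
    using card pc(2) C(2) that by auto
  have sub: "Y \<subseteq> N (Suc i)" if "Y \<lhd> G" "(#>) (N i) ` Y \<subseteq> C" for Y
    using that C(1) subgroup.subset[OF normal_imp_subgroup[OF that(1)]] by auto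
  have img: "card ((#>) (N i) ` Y) = c" if "Y \<lhd> G" "N i \<subseteq> Y" "card Y = card (N i) * c" for Y c
    using N.card_coset_image[OF normal_imp_subgroup[OF that(1)] that(2)] that(3) pos by simp
  show "Y \<subseteq> N (Suc i)" if "even i" "Y \<lhd> G" "N i \<subseteq> Y" "card Y = card (N i) * c" "coprime p c"
    using sub[OF that(2)] pp(3)[OF N.normal_image_coset[OF that(2)]] img[OF that(2-4)] that C(2) by simp
  show "Y \<subseteq> N (Suc i)" if "odd i" "Y \<lhd> G" "N i \<subseteq> Y" "card Y = card (N i) * p ^ k"
    using sub[OF that(2)] pc(3)[OF N.normal_image_coset[OF that(2)]] img[OF that(2-4)] that C(2) by simp
qed

text \<open>If a \<open>p\<close>-step at \<open>i\<close> adds nothing, the quotient by the \<open>i\<close>-th term has no nontrivial normal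
  \<open>p\<close>-subgroup. It has no nontrivial normal \<open>p'\<close>-subgroup either, because the preceding step
  already took the largest one. A solvable group with neither is trivial.\<close>

lemma lower_p_series_stationary_imp_carrier:
  assumes "solvable G" and "odd i" and eq: "lower_p_series p G i = lower_p_series p G (Suc i)"
  shows "lower_p_series p G i = carrier G"
proof (rule ccontr)
  assume ne: "lower_p_series p G i \<noteq> carrier G"
  obtain j where j: "i = Suc j" "even j" using \<open>odd i\<close> by (cases i) auto
  define N where "N = lower_p_series p G"
  interpret N: normal "N i" G unfolding N_def by (rule lower_p_series_normal)
  let ?Q = "G Mod N i"
  interpret Q: group ?Q by (rule N.factorgroup_is_group)
  interpret hom: group_hom G ?Q "(#>) (N i)"
    by (simp add: group_hom_def group_hom_axioms_def is_group N.factorgroup_is_group N.r_coset_hom_Mod)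
  have "solvable ?Q" using hom.surj_hom_imp_solvable \<open>solvable G\<close> by (simp add: carrier_FactGroup)
  moreover have "carrier ?Q \<noteq> {\<one>\<^bsub>?Q\<^esub>}"
  proof
    assume triv: "carrier ?Q = {\<one>\<^bsub>?Q\<^esub>}"
    have "x \<in> N i" if "x \<in> carrier G" for x
    proof -
      have "N i #> x = N i" using triv that by (auto simp: carrier_FactGroup)
      then show ?thesis using that N.subset N.is_subgroup coset_join1 by blast
    qed
    then show False using ne N.subset by (auto simp: N_def)
  qed
  ultimately obtain Y where Y: "Y \<lhd> ?Q" "Y \<noteq> {\<one>\<^bsub>?Q\<^esub>}"
    "(\<exists>k. card Y = p ^ k) \<or> coprime p (card Y)"
    using Q.solvable_imp_normal_p_or_pprime[OF finite_Mod _ _ p] by blast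
  define X where "X = {x \<in> carrier G. N i #> x \<in> Y}"
  have X: "X \<lhd> G" "N i \<subseteq> X" "card X = card (N i) * card Y"
    unfolding X_def using N.normal_preimage_coset N.subset_preimage_coset N.card_preimage_coset Y(1) by auto
  have Y1: "card Y \<noteq> 1"
  proof
    assume "card Y = 1"
    then show False using Y(2) subgroup.one_closed[OF normal_imp_subgroup[OF Y(1)]]
      by (metis card_1_singletonE singletonD)
  qed
  have "X \<subseteq> N i"
  proof (cases "\<exists>k. card Y = p ^ k")
    case True
    then obtain k where "card X = card (N i) * p ^ k" using X(3) by auto
    then show ?thesis using lower_p_series_step(5)[OF \<open>odd i\<close> X(1)] X(2) eq unfolding N_def by blast
  next
    case False
    then have "coprime p (card Y)" using Y(3) by blast
    moreover obtain c where c: "card (N i) = card (N j) * c" "coprime p c"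
      using lower_p_series_step(2)[OF j(2)] j(1) unfolding N_def by blast
    ultimately have "card X = card (N j) * (c * card Y)" "coprime p (c * card Y)"
      using X(3) by simp_all
    moreover have "N j \<subseteq> X" using lower_p_series_step(1)[of j] j(1) X(2) unfolding N_def by auto
    ultimately show ?thesis
      using lower_p_series_step(4)[OF j(2) X(1)] j(1) unfolding N_def by blast
  qed
  then have "X = N i" using X(2) by blast
  moreover have "card (N i) > 0" by (rule N.finite_imp_card_positive[OF fin])
  ultimately show False using X(3) Y1 by simp
qed

text \<open>The indices \<open>1\<close> and \<open>3\<close> cannot both be counted by the \<open>p\<close>-length, so one of these two \<open>p\<close>-steps
  is stationary, and the series has reached \<open>G\<close> by index \<open>3\<close>. Its terms \<open>1\<close> and \<open>2\<close> serve as
  \<open>M\<close> and \<open>T\<close>.\<close>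

lemma p_length_le_1_imp_pprime_p_pprime_series:
  assumes "solvable G" and "p_length p G \<le> 1"
  obtains M T k c where "M \<lhd> G" "T \<lhd> G" "M \<subseteq> T" "coprime p (card M)"
    "card T = card M * p ^ k" "card (carrier G) = card T * c" "coprime p c"
proof -
  define N where "N = lower_p_series p G"
  let ?I = "{i. odd i \<and> N i \<noteq> N (Suc i)}"
  have mono: "N i \<subseteq> N j" if "i \<le> j" for i j
    using that unfolding N_def by (rule lift_Suc_mono_le[of "lower_p_series p G", OF lower_p_series_step(1)])
  have sub: "N i \<subseteq> carrier G" for i
    unfolding N_def using lower_p_series_normal normal_imp_subgroup subgroup.subset by blast
  have finN: "finite (N i)" for i using sub fin finite_subset by blast
  \<comment> \<open>Finiteness has to be shown first: the cardinality of an infinite set is \<open>0\<close>, so the bound on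
    the \<open>p\<close>-length would otherwise say nothing.\<close>
  have finI: "finite ?I"
  proof (rule inj_on_finite)
    show "inj_on (\<lambda>i. card (N i)) ?I"
    proof (rule linorder_inj_onI')
      fix i j assume ij: "i \<in> ?I" "j \<in> ?I" "i < j"
      have "N i \<subset> N (Suc i)" using ij(1) mono[of i "Suc i"] by auto
      then have "card (N i) < card (N (Suc i))" using finN psubset_card_mono by blast
      also have "\<dots> \<le> card (N j)" using card_mono[OF finN mono[of "Suc i" j]] ij(3) by simp
      finally show "card (N i) \<noteq> card (N j)" by simp
    qed
    show "(\<lambda>i. card (N i)) ` ?I \<subseteq> {..card (carrier G)}" using card_mono[OF fin sub] by auto
  qed simp
  have le: "card ?I \<le> 1" using assms(2) unfolding p_length_def N_def .
  have "\<not> {1, 3} \<subseteq> ?I" using card_mono[OF finI, of "{1,3}"] le by auto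
  moreover have stationary: "N i = carrier G" if "odd i" "i \<notin> ?I" for i
    using lower_p_series_stationary_imp_carrier[OF assms(1), of i] that by (simp add: N_def)
  ultimately have "N 1 = carrier G \<or> N 3 = carrier G"
    using stationary[of 1] stationary[of 3] by (meson empty_subsetI insert_subset odd_numeral odd_one)
  then have N3: "N 3 = carrier G" using mono[of 1 3] sub[of 3] by auto
  have "card (N 0) = 1" by (simp add: N_def)
  then have "coprime p (card (N 1))"
    using lower_p_series_step(2)[of 0] unfolding N_def by auto
  moreover obtain k where "card (N 2) = card (N 1) * p ^ k"
    using lower_p_series_step(3)[of 1] unfolding N_def by (auto simp: numeral_2_eq_2)
  moreover obtain c where "card (N 3) = card (N 2) * c" "coprime p c"
    using lower_p_series_step(2)[of 2] unfolding N_def by (auto simp: numeral_3_eq_3 numeral_2_eq_2)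
  moreover have "N 1 \<lhd> G" "N 2 \<lhd> G" unfolding N_def by (rule lower_p_series_normal)+
  ultimately show ?thesis using that[of "N 1" "N 2" k c] mono[of 1 2] N3 by simp
qed

end
end

section \<open>Chief factors centralized by the p-step\<close>

context group
begin

lemma normal_centralizer:
  assumes "T \<lhd> G"
  shows "{x \<in> carrier G. \<forall>t\<in>T. t \<otimes> x = x \<otimes> t} \<lhd> G" (is "?C \<lhd> G")
proof -
  interpret T: normal T G by fact
  show ?thesis unfolding normal_inv_iff
  proof (intro conjI ballI)
    show "subgroup ?C G"
    proof (rule subgroupI)
      show "?C \<noteq> {}" using T.mem_carrier by (auto intro!: exI[of _ \<one>])
      show "inv x \<in> ?C" if x: "x \<in> ?C" for x
      proof -
        have "t \<otimes> inv x = inv x \<otimes> t" if t: "t \<in> T" for t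
        proof -
          have tG: "t \<in> carrier G" using t T.mem_carrier by simp
          have "x \<otimes> (t \<otimes> inv x) = (t \<otimes> x) \<otimes> inv x"
            using x t tG by (simp add: m_assoc[symmetric])
          also have "\<dots> = t" using x tG by (simp add: m_assoc)
          finally show ?thesis using inv_solve_left[of "t \<otimes> inv x" x t] x tG by simp
        qed
        then show ?thesis using x by simp
      qed
      show "x \<otimes> y \<in> ?C" if xy: "x \<in> ?C" "y \<in> ?C" for x y
      proof -
        have "t \<otimes> (x \<otimes> y) = x \<otimes> y \<otimes> t" if t: "t \<in> T" for t
        proof -
          have tG: "t \<in> carrier G" using t T.mem_carrier by simp
          have "t \<otimes> (x \<otimes> y) = (t \<otimes> x) \<otimes> y" using xy tG by (simp add: m_assoc)
          also have "\<dots> = x \<otimes> (t \<otimes> y)" using xy t tG by (simp add: m_assoc)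
          also have "\<dots> = x \<otimes> y \<otimes> t" using xy t tG by (simp add: m_assoc)
          finally show ?thesis .
        qed
        then show ?thesis using xy by simp
      qed
    qed auto
    fix g x assume g: "g \<in> carrier G" and x: "x \<in> ?C"
    have "t \<otimes> (g \<otimes> x \<otimes> inv g) = g \<otimes> x \<otimes> inv g \<otimes> t" if t: "t \<in> T" for t
    proof -
      have tG: "t \<in> carrier G" using t T.mem_carrier by simp
      define u where "u = inv g \<otimes> t \<otimes> g"
      have u: "u \<in> T" "u \<in> carrier G" unfolding u_def using T.inv_op_closed1[OF g t] g tG by auto
      have 1: "t \<otimes> g = g \<otimes> u" and 2: "inv g \<otimes> t = u \<otimes> inv g"
        unfolding u_def using g tG inv_solve_left[of "inv g \<otimes> (t \<otimes> g)" g "t \<otimes> g"] by (simp_all add: m_assoc)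
      have "t \<otimes> (g \<otimes> x \<otimes> inv g) = (t \<otimes> g) \<otimes> x \<otimes> inv g" using g x tG by (simp add: m_assoc)
      also have "\<dots> = g \<otimes> (u \<otimes> x) \<otimes> inv g" using 1 g x u by (simp add: m_assoc)
      also have "\<dots> = g \<otimes> x \<otimes> (u \<otimes> inv g)" using x u g by (simp add: m_assoc)
      also have "\<dots> = g \<otimes> x \<otimes> inv g \<otimes> t" using 2 g x u tG by (simp add: m_assoc)
      finally show ?thesis .
    qed
    then show "g \<otimes> x \<otimes> inv g \<in> ?C" using g x by simp
  qed
qed

text \<open>The homomorphism \<open>h\<close> lets a subgroup of \<open>G\<close> act on a normal subgroup of a quotient of \<open>G\<close>.\<close>

lemma normal_conjugation_action:
  assumes "B \<lhd> G" "group S" "h \<in> hom S G"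
  shows "group_action S B (\<lambda>s. \<lambda>x\<in>B. h s \<otimes> x \<otimes> inv (h s))" (is "group_action S B ?f")
proof -
  interpret B: normal B G by fact
  interpret S: group S by fact
  interpret h: group_hom S G h
    using assms(3) by (simp add: group_hom_def group_hom_axioms_def is_group S.is_group)
  have closed: "h s \<otimes> x \<otimes> inv (h s) \<in> B" if "s \<in> carrier S" "x \<in> B" for s x
    using that B.inv_op_closed2 by simp
  have comp: "?f (s \<otimes>\<^bsub>S\<^esub> t) x = ?f s (?f t x)" if "s \<in> carrier S" "t \<in> carrier S" "x \<in> B" for s t x
    using that closed B.mem_carrier by (simp add: inv_mult_group m_assoc)
  have one: "?f \<one>\<^bsub>S\<^esub> x = x" if "x \<in> B" for x using that B.mem_carrier by simp
  have Bij: "?f s \<in> Bij B" if s: "s \<in> carrier S" for s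
  proof -
    have "bij_betw (?f s) B B"
    proof (rule bij_betw_byWitness[where f' = "?f (inv\<^bsub>S\<^esub> s)"])
      show "\<forall>x\<in>B. ?f (inv\<^bsub>S\<^esub> s) (?f s x) = x"
        using comp[of "inv\<^bsub>S\<^esub> s" s] s one by (metis S.inv_closed S.l_inv)
      show "\<forall>x\<in>B. ?f s (?f (inv\<^bsub>S\<^esub> s) x) = x"
        using comp[of s "inv\<^bsub>S\<^esub> s"] s one by (metis S.inv_closed S.r_inv)
    qed (use closed[OF s] closed[OF S.inv_closed[OF s]] in auto)
    then show ?thesis by (simp add: Bij_def)
  qed
  have "?f (s \<otimes>\<^bsub>S\<^esub> t) = compose B (?f s) (?f t)" if "s \<in> carrier S" "t \<in> carrier S" for s t
    using comp[OF that] by (intro ext) (simp add: compose_def restrict_def)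
  then show ?thesis
    using Bij group_BijGroup[of B] by (auto simp: group_action_def group_hom_def group_hom_axioms_def S.is_group
        hom_def BijGroup_def)
qed

text \<open>The pair \<open>A = B\<close> counts as a chief factor. It has order \<open>1\<close>, and only factors of order divisible by
  a prime \<open>p\<close> are ever considered.\<close>

definition chief_factor :: "'a set \<Rightarrow> 'a set \<Rightarrow> bool"
  where "chief_factor A B \<longleftrightarrow> A \<lhd> G \<and> B \<lhd> G \<and> A \<subseteq> B \<and>
    (\<forall>N. N \<lhd> G \<and> A \<subseteq> N \<and> N \<subseteq> B \<longrightarrow> N = A \<or> N = B)"

text \<open>The elements of \<open>T\<close> act trivially on \<open>B/A\<close>. For \<open>M\<close> this holds because
  \<open>[M, B] \<subseteq> M \<inter> B\<close>, and \<open>M \<inter> B\<close> is too small modulo \<open>A\<close> to be all of \<open>B/A\<close>, whose order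
  is divisible by \<open>p\<close>. Thus \<open>T\<close> acts on \<open>B/A\<close> through the \<open>p\<close>-group \<open>T/M\<close>. It therefore has a
  fixed point other than the identity, and the fixed points form a normal subgroup of \<open>G/A\<close>, which
  must be all of \<open>B/A\<close>.\<close>

lemma chief_factor_centralized:
  assumes fin: "finite (carrier G)" and p: "Factorial_Ring.prime p"
    and chief: "chief_factor A B" and index: "card B = card A * c" "p dvd c"
    and M: "M \<lhd> G" "coprime p (card M)"
    and T: "T \<lhd> G" "M \<subseteq> T" "card T = card M * p ^ k"
    and t: "t \<in> T" and b: "b \<in> B"
  shows "t \<otimes> b \<otimes> inv t \<otimes> inv b \<in> A"
proof -
  interpret A: normal A G using chief by (simp add: chief_factor_def)
  interpret B: normal B G using chief by (simp add: chief_factor_def)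
  interpret M: normal M G by fact
  interpret T: normal T G by fact
  have AB: "A \<subseteq> B" and between: "\<And>N. N \<lhd> G \<Longrightarrow> A \<subseteq> N \<Longrightarrow> N \<subseteq> B \<Longrightarrow> N = A \<or> N = B"
    using chief by (auto simp: chief_factor_def)
  have posA: "card A > 0" by (rule A.finite_imp_card_positive[OF fin])
  let ?Q = "G Mod A" and ?B = "(#>) A ` B" and ?T = "(#>) A ` T"
  interpret Q: group ?Q by (rule A.factorgroup_is_group)
  interpret \<pi>: group_hom G ?Q "(#>) A"
    by (simp add: group_hom_def group_hom_axioms_def is_group A.factorgroup_is_group A.r_coset_hom_Mod)
  have coset_eq_iff: "A #> x = A #> y \<longleftrightarrow> x \<otimes> inv y \<in> A" if "x \<in> carrier G" "y \<in> carrier G" for x y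
  proof
    assume "A #> x = A #> y"
    then have "x \<in> A #> y" using that rcos_self A.is_subgroup by blast
    then show "x \<otimes> inv y \<in> A" using A.rcos_module_imp[OF is_group] that by blast
  next
    assume "x \<otimes> inv y \<in> A"
    then have "x \<in> A #> y" using A.rcos_module_rev[OF is_group] that by blast
    then show "A #> x = A #> y" using repr_independence that A.is_subgroup by metis
  qed
  have MB: "M \<inter> B \<subseteq> A"
  proof -
    have MBn: "M \<inter> B \<lhd> G" using normal_subgroup_intersect M.normal_axioms B.normal_axioms by blast
    note MBs = normal_imp_subgroup[OF MBn]
    have "A <#> (M \<inter> B) = A \<or> A <#> (M \<inter> B) = B"
      using between normal_subgroup_set_mult_closed[OF A.normal_axioms MBn]
        subgroup_set_mult[OF A.normal_axioms MBs] set_mult_subset[OF B.is_subgroup AB] by auto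
    moreover have "A <#> (M \<inter> B) \<noteq> B"
    proof
      assume "A <#> (M \<inter> B) = B"
      then have "c * card (A \<inter> (M \<inter> B)) = card (M \<inter> B)"
        using card_set_mult[OF A.normal_axioms MBs] index(1) posA by simp
      then have "p dvd card (M \<inter> B)" using index(2) by (metis dvd_mult2)
      then have "p dvd card M" using card_subgroup_dvd[OF MBs M.is_subgroup] dvd_trans by blast
      then show False using M(2) p by (metis coprime_absorb_left not_prime_unit)
    qed
    ultimately show ?thesis using subgroup_set_mult(3)[OF A.normal_axioms MBs] by auto
  qed
  let ?GT = "G\<lparr>carrier := T\<rparr>" and ?f = "\<lambda>s. \<lambda>x\<in>?B. (A #> s) \<otimes>\<^bsub>?Q\<^esub> x \<otimes>\<^bsub>?Q\<^esub> inv\<^bsub>?Q\<^esub> (A #> s)"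
  have Bn: "?B \<lhd> ?Q" by (rule A.normal_image_coset[OF B.normal_axioms])
  have Tn: "?T \<lhd> ?Q" by (rule A.normal_image_coset[OF T.normal_axioms])
  interpret GT: group ?GT using T.is_subgroup subgroup_imp_group by blast
  have "(#>) A \<in> hom ?GT ?Q"
    using \<pi>.hom_mult \<pi>.hom_closed T.mem_carrier by (auto simp: hom_def)
  then interpret act: group_action ?GT ?B ?f
    by (rule Q.normal_conjugation_action[OF Bn GT.is_group])
  have in_B: "A #> x \<in> ?B \<longleftrightarrow> x \<in> B" if x: "x \<in> carrier G" for x
  proof
    assume "A #> x \<in> ?B"
    then obtain y where y: "y \<in> B" "A #> x = A #> y" by blast
    then have "x \<otimes> inv y \<in> B" using coset_eq_iff x AB B.mem_carrier by blast
    then have "x \<otimes> inv y \<otimes> y \<in> B" using y(1) by blast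
    then show "x \<in> B" using x y(1) B.mem_carrier by (simp add: m_assoc)
  qed auto
  have fixed_iff: "?f s X = X \<longleftrightarrow> (A #> s) \<otimes>\<^bsub>?Q\<^esub> X = X \<otimes>\<^bsub>?Q\<^esub> (A #> s)" if "s \<in> T" "X \<in> ?B" for s X
  proof -
    have "A #> s \<in> carrier ?Q" "X \<in> carrier ?Q"
      using that T.mem_carrier subgroup.subset[OF normal_imp_subgroup[OF Bn]] \<pi>.hom_closed by auto
    then show ?thesis using that(2) by (simp add: Q.inv_solve_right'[symmetric] del: mult_FactGroup)
  qed
  have comm_iff: "(A #> s) \<otimes>\<^bsub>?Q\<^esub> (A #> x) = (A #> x) \<otimes>\<^bsub>?Q\<^esub> (A #> s) \<longleftrightarrow> s \<otimes> x \<otimes> inv s \<otimes> inv x \<in> A"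
    if "s \<in> carrier G" "x \<in> carrier G" for s x
  proof -
    have "s \<otimes> x \<otimes> inv (x \<otimes> s) = s \<otimes> x \<otimes> inv s \<otimes> inv x"
      using that by (simp add: inv_mult_group m_assoc)
    moreover have "(A #> s) \<otimes>\<^bsub>?Q\<^esub> (A #> x) = A #> (s \<otimes> x)" "(A #> x) \<otimes>\<^bsub>?Q\<^esub> (A #> s) = A #> (x \<otimes> s)"
      using \<pi>.hom_mult that by simp_all
    ultimately show ?thesis
      using that coset_eq_iff[of "s \<otimes> x" "x \<otimes> s"] by simp
  qed
  have "\<exists>X\<in>?B. X \<noteq> \<one>\<^bsub>?Q\<^esub> \<and> (\<forall>s\<in>carrier ?GT. ?f s X = X)"
  proof (rule act.p_power_orbits_imp_second_fixed_point[where M = M and k = k])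
    show "finite ?B" using fin B.subset finite_subset by blast
    show "Factorial_Ring.prime p" by fact
    show "p dvd card ?B" using A.card_coset_image[OF B.is_subgroup AB] index posA by simp
    show "\<one>\<^bsub>?Q\<^esub> \<in> ?B" by (rule subgroup.one_closed[OF normal_imp_subgroup[OF Bn]])
    then show "?f g \<one>\<^bsub>?Q\<^esub> = \<one>\<^bsub>?Q\<^esub>" if "g \<in> carrier ?GT" for g
      using fixed_iff[of g "\<one>\<^bsub>?Q\<^esub>"] that T.mem_carrier \<pi>.hom_closed by (simp del: mult_FactGroup one_FactGroup)
    show "subgroup M ?GT" by (rule subgroup_incl[OF M.is_subgroup T.is_subgroup T(2)])
    show "?f g X = X" if g: "g \<in> M" and X: "X \<in> ?B" for g X
    proof -
      obtain x where x: "x \<in> B" "X = A #> x" using X by blast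
      have gG: "g \<in> carrier G" "x \<in> carrier G" using g x M.mem_carrier B.mem_carrier by auto
      have "g \<otimes> (x \<otimes> inv g \<otimes> inv x) \<in> M"
        using g gG M.inv_op_closed2[of x "inv g"] by simp
      moreover have "(g \<otimes> x \<otimes> inv g) \<otimes> inv x \<in> B"
        using x gG B.inv_op_closed2[of g x] by simp
      ultimately have "g \<otimes> x \<otimes> inv g \<otimes> inv x \<in> A" using MB gG by (auto simp: m_assoc)
      then have "(A #> g) \<otimes>\<^bsub>?Q\<^esub> X = X \<otimes>\<^bsub>?Q\<^esub> (A #> g)"
        unfolding x(2) by (rule iffD2[OF comm_iff[OF gG]])
      then show ?thesis using g T(2) by (intro iffD2[OF fixed_iff[OF _ X]]) auto
    qed
    show "order ?GT = card M * p ^ k" using T(3) by (simp add: order_def)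
    show "finite (carrier ?GT)" using fin T.subset finite_subset by auto
  qed
  then obtain X where X: "X \<in> ?B" "X \<noteq> \<one>\<^bsub>?Q\<^esub>" "\<And>s. s \<in> T \<Longrightarrow> ?f s X = X" by auto
  define C where "C = {x \<in> carrier ?Q. \<forall>t\<in>?T. t \<otimes>\<^bsub>?Q\<^esub> x = x \<otimes>\<^bsub>?Q\<^esub> t}"
  have Cn: "C \<inter> ?B \<lhd> ?Q"
    using Q.normal_subgroup_intersect[OF Q.normal_centralizer[OF Tn] Bn] unfolding C_def .
  define F where "F = {x \<in> carrier G. A #> x \<in> C \<inter> ?B}"
  have "F \<lhd> G" "A \<subseteq> F"
    unfolding F_def using A.normal_preimage_coset[OF Cn] A.subset_preimage_coset[OF Cn] by auto
  moreover have "F \<subseteq> B" unfolding F_def using in_B by auto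
  moreover have "F \<noteq> A"
  proof
    assume FA: "F = A"
    have "X \<in> carrier ?Q" using X(1) subgroup.subset[OF normal_imp_subgroup[OF Bn]] by blast
    then have "X \<in> C" unfolding C_def using X(1,3) fixed_iff by auto
    moreover obtain x where x: "x \<in> B" "X = A #> x" using X(1) by blast
    ultimately have "x \<in> F" unfolding F_def using X(1) B.mem_carrier by auto
    then have "X = A" using x FA A.rcos_const[OF is_group] by auto
    then show False using X(2) by simp
  qed
  ultimately have "F = B" using between by blast
  then have "A #> b \<in> C" using b unfolding F_def by auto
  then show ?thesis
    unfolding C_def using t comm_iff[of t b] T.mem_carrier B.mem_carrier b by auto
qed

end

section \<open>Covering and avoiding chief factors\<close>

context group
begin

text \<open>The subgroup \<open>A(S \<inter> B)\<close> is normalized by \<open>K\<close>, because \<open>S\<close> is, and by \<open>T\<close>, because \<open>T\<close>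
  centralizes \<open>B/A\<close>. Since \<open>G = TK\<close>, it is normal in \<open>G\<close>. In the usual terms, \<open>S\<close> avoids or covers
  the chief factor \<open>B/A\<close>.\<close>

lemma chief_factor_cover_or_avoid:
  assumes fin: "finite (carrier G)" and p: "Factorial_Ring.prime p"
    and chief: "chief_factor A B" and less: "multiplicity p (card A) < multiplicity p (card B)"
    and M: "M \<lhd> G" "coprime p (card M)"
    and T: "T \<lhd> G" "M \<subseteq> T" "card T = card M * p ^ k"
    and K: "K \<subseteq> carrier G" "T <#> K = carrier G"
    and S: "subgroup S G" "\<And>x s. x \<in> K \<Longrightarrow> s \<in> S \<Longrightarrow> x \<otimes> s \<otimes> inv x \<in> S"
  shows "A <#> (S \<inter> B) = A \<or> A <#> (S \<inter> B) = B"
proof -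
  interpret A: normal A G using chief by (simp add: chief_factor_def)
  interpret B: normal B G using chief by (simp add: chief_factor_def)
  interpret T: normal T G by fact
  interpret S: subgroup S G by fact
  have AB: "A \<subseteq> B" using chief by (simp add: chief_factor_def)
  obtain c where c: "card B = card A * c"
    using card_subgroup_dvd[OF A.is_subgroup B.is_subgroup AB] by blast
  have pos: "card A > 0" "card B > 0"
    using A.finite_imp_card_positive[OF fin] B.finite_imp_card_positive[OF fin] by auto
  have "p dvd c"
  proof (rule ccontr)
    assume "\<not> p dvd c"
    then have "multiplicity p (card B) = multiplicity p (card A)"
      using c pos p by (simp add: prime_elem_multiplicity_mult_distrib not_dvd_imp_multiplicity_0)
    then show False using less by simp
  qed
  note central = chief_factor_centralized[OF fin p chief c this M T]
  let ?X = "A <#> (S \<inter> B)"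
  have SB: "subgroup (S \<inter> B) G" by (rule subgroups_Inter_pair[OF S(1) B.is_subgroup])
  note X = subgroup_set_mult[OF A.normal_axioms SB]
  have XB: "?X \<subseteq> B" using set_mult_subset[OF B.is_subgroup AB] by blast
  interpret X: subgroup ?X G by (rule X(1))
  have byT: "t \<otimes> x \<otimes> inv t \<in> ?X" if t: "t \<in> T" and x: "x \<in> ?X" for t x
  proof -
    have G: "t \<in> carrier G" "x \<in> carrier G" using t x by auto
    have "t \<otimes> x \<otimes> inv t \<otimes> inv x \<in> ?X" using central[OF t] x XB X(2) by blast
    then have "t \<otimes> x \<otimes> inv t \<otimes> inv x \<otimes> x \<in> ?X" using x by blast
    then show ?thesis using G by (simp add: m_assoc)
  qed
  have byK: "g \<otimes> x \<otimes> inv g \<in> ?X" if g: "g \<in> K" and x: "x \<in> ?X" for g x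
  proof -
    obtain a s where as: "a \<in> A" "s \<in> S" "s \<in> B" "x = a \<otimes> s" using x by (auto simp: set_mult_def)
    have G: "g \<in> carrier G" using g K(1) by blast
    have "g \<otimes> x \<otimes> inv g = (g \<otimes> a \<otimes> inv g) \<otimes> (g \<otimes> s \<otimes> inv g)"
    proof -
      have "inv g \<otimes> (g \<otimes> (s \<otimes> inv g)) = s \<otimes> inv g"
        using G as m_assoc[of "inv g" g "s \<otimes> inv g", symmetric] by simp
      then show ?thesis using G as by (simp add: m_assoc)
    qed
    moreover have "g \<otimes> a \<otimes> inv g \<in> A" using A.inv_op_closed2 G as by blast
    moreover have "g \<otimes> s \<otimes> inv g \<in> S \<inter> B" using S(2) B.inv_op_closed2 G g as by blast
    ultimately show ?thesis unfolding set_mult_def by blast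
  qed
  have "?X \<lhd> G" unfolding normal_inv_iff
  proof (intro conjI ballI)
    fix g x assume g: "g \<in> carrier G" and x: "x \<in> ?X"
    have "g \<in> T <#> K" using g K(2) by simp
    then obtain t k where tk: "t \<in> T" "k \<in> K" "g = t \<otimes> k" by (auto simp: set_mult_def)
    have "t \<otimes> (k \<otimes> x \<otimes> inv k) \<otimes> inv t \<in> ?X" using byT byK tk x by blast
    moreover have "k \<in> carrier G" "x \<in> carrier G" using K(1) tk x by auto
    ultimately show "g \<otimes> x \<otimes> inv g \<in> ?X" using tk by (simp add: m_assoc inv_mult_group)
  qed (rule X(1))
  then show ?thesis using chief X(2) XB unfolding chief_factor_def by blast
qed

lemma exists_chief_series_above:
  assumes fin: "finite (carrier G)" and "A \<lhd> G"
  shows "\<exists>N r. N 0 = A \<and> N r = carrier G \<and> (\<forall>i<r. chief_factor (N i) (N (Suc i)))"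
  using assms(2)
proof (induction "card (carrier G) - card A" arbitrary: A rule: less_induct)
  case less
  have sub: "N \<subseteq> carrier G" if "N \<lhd> G" for N
    using that normal_imp_subgroup subgroup.subset by blast
  show ?case
  proof (cases "A = carrier G")
    case True
    then show ?thesis by (intro exI[of _ "\<lambda>_. A"] exI[of _ 0]) simp
  next
    case False
    let ?P = "\<lambda>B. B \<lhd> G \<and> A \<subset> B"
    have "?P (carrier G)" using False sub[OF less.prems] normal_self by auto
    then obtain B where B: "?P B" and min: "\<And>N. ?P N \<Longrightarrow> card B \<le> card N"
      using ex_has_least_nat[of ?P "carrier G" card] by blast
    have finB: "finite B" using B sub[of B] finite_subset[OF _ fin] by simp
    have "chief_factor A B"
      unfolding chief_factor_def
    proof (intro conjI allI impI)
      fix N assume N: "N \<lhd> G \<and> A \<subseteq> N \<and> N \<subseteq> B"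
      show "N = A \<or> N = B"
      proof (rule disjCI)
        assume "N \<noteq> B"
        then have "card N < card B" using N finB by (intro psubset_card_mono) auto
        then have "\<not> ?P N" using min[of N] by linarith
        then show "N = A" using N by auto
      qed
    qed (use less.prems B in auto)
    have "card A < card B" using B finB psubset_card_mono by blast
    moreover have "card B \<le> card (carrier G)" using B sub[of B] card_mono[OF fin] by simp
    ultimately have "card (carrier G) - card B < card (carrier G) - card A" by simp
    from less.hyps[OF this] B obtain N r where N: "N 0 = B" "N r = carrier G"
      "\<forall>i<r. chief_factor (N i) (N (Suc i))" by blast
    have "\<forall>i<Suc r. chief_factor (case_nat A N i) (case_nat A N (Suc i))"
      using N \<open>chief_factor A B\<close> by (auto split: nat.split)
    then show ?thesis using N by (intro exI[of _ "case_nat A N"] exI[of _ "Suc r"]) simp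
  qed
qed

end

locale p_length_one_chief_series = group +
  fixes p k :: nat and M T K :: "'a set" and N :: "nat \<Rightarrow> 'a set" and r :: nat
  assumes fin: "finite (carrier G)" and p: "Factorial_Ring.prime p"
    and M: "M \<lhd> G" "coprime p (card M)"
    and T: "T \<lhd> G" "M \<subseteq> T" "card T = card M * p ^ k"
    and K: "subgroup K G" "T <#> K = carrier G"
    and N: "N 0 = {\<one>}" "N r = carrier G" "\<And>i. i < r \<Longrightarrow> chief_factor (N i) (N (Suc i))"
begin

abbreviation v :: "'a set \<Rightarrow> nat"
  where "v S \<equiv> multiplicity p (card S)"

text \<open>For a subgroup that covers or avoids every chief factor of order divisible by \<open>p\<close>, these are the
  positions of the factors it covers. The definition by orders makes sense for every subgroup, which
  is needed for the maximal subgroup \<open>H\<close>: it need not be invariant under conjugation by \<open>K\<close>.\<close>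

definition covered :: "'a set \<Rightarrow> nat set"
  where "covered S = {i. i < r \<and> v (S \<inter> N i) < v (S \<inter> N (Suc i))}"

definition K_invariant :: "'a set \<Rightarrow> bool"
  where "K_invariant S \<longleftrightarrow> subgroup S G \<and> (\<forall>x\<in>K. \<forall>s\<in>S. x \<otimes> s \<otimes> inv x \<in> S)"

lemma finite_covered: "finite (covered S)"
  by (simp add: covered_def)

lemma N_normal: "i \<le> r \<Longrightarrow> N i \<lhd> G"
  using N(3)[of i] N(2) normal_self by (cases "i = r") (auto simp: chief_factor_def)

lemma carrier_Int_N: "i \<le> r \<Longrightarrow> carrier G \<inter> N i = N i"
  using subgroup.subset[OF normal_imp_subgroup[OF N_normal]] by (simp add: Int_absorb1)

lemma N_mono: "i < r \<Longrightarrow> N i \<subseteq> N (Suc i)"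
  using N(3) by (simp add: chief_factor_def)

lemma card_pos: "subgroup S G \<Longrightarrow> card S > 0"
  using subgroup.finite_imp_card_positive fin by blast

lemma subgroup_Int_N: "subgroup S G \<Longrightarrow> i \<le> r \<Longrightarrow> subgroup (S \<inter> N i) G"
  using N_normal normal_imp_subgroup subgroups_Inter_pair by blast

text \<open>The product formula for \<open>A(S \<inter> B)\<close> on a factor \<open>B/A\<close> of the series, read on \<open>p\<close>-parts.\<close>

lemma v_set_mult_Int:
  assumes S: "subgroup S G" and i: "i < r"
  shows "v (N i <#> (S \<inter> N (Suc i))) + v (S \<inter> N i) = v (N i) + v (S \<inter> N (Suc i))"
proof -
  have Ni: "N i \<lhd> G" using N_normal i by simp
  have SN: "subgroup (S \<inter> N (Suc i)) G" using subgroup_Int_N S i by simp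
  have "N i \<inter> (S \<inter> N (Suc i)) = S \<inter> N i" using N_mono[OF i] by blast
  then have "card (N i <#> (S \<inter> N (Suc i))) * card (S \<inter> N i) = card (N i) * card (S \<inter> N (Suc i))"
    using card_set_mult[OF Ni SN] by simp
  then have "multiplicity p (card (N i <#> (S \<inter> N (Suc i))) * card (S \<inter> N i))
    = multiplicity p (card (N i) * card (S \<inter> N (Suc i)))" by simp
  moreover have "card (N i <#> (S \<inter> N (Suc i))) > 0" "card (S \<inter> N i) > 0" "card (N i) > 0" "card (S \<inter> N (Suc i)) > 0"
    using card_pos subgroup_set_mult(1)[OF Ni SN] subgroup_Int_N[OF S] i normal_imp_subgroup[OF Ni] SN by auto
  ultimately show ?thesis
    using p by (simp add: prime_elem_multiplicity_mult_distrib)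
qed

lemma v_mono: "subgroup A G \<Longrightarrow> subgroup B G \<Longrightarrow> A \<subseteq> B \<Longrightarrow> v A \<le> v B"
  using card_subgroup_dvd card_pos by (metis dvd_imp_multiplicity_le less_numeral_extra(3))

lemma covered_imp_p_factor:
  assumes S: "subgroup S G" and i: "i \<in> covered S"
  shows "v (N i) < v (N (Suc i))"
proof -
  have ir: "i < r" using i by (simp add: covered_def)
  have Ni: "N i \<lhd> G" "N (Suc i) \<lhd> G" using N_normal ir by simp_all
  have SN: "subgroup (S \<inter> N (Suc i)) G" using subgroup_Int_N S ir by simp
  have "v (N i <#> (S \<inter> N (Suc i))) \<le> v (N (Suc i))"
    using v_mono subgroup_set_mult(1)[OF Ni(1) SN] normal_imp_subgroup[OF Ni(2)]
      set_mult_subset[OF normal_imp_subgroup[OF Ni(2)] N_mono[OF ir], of "S \<inter> N (Suc i)"] by simp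
  then show ?thesis using v_set_mult_Int[OF S ir] i by (simp add: covered_def)
qed

lemma K_invariant_cover_or_avoid:
  assumes "K_invariant S" "i < r" "v (N i) < v (N (Suc i))"
  shows "N i <#> (S \<inter> N (Suc i)) = N i \<or> N i <#> (S \<inter> N (Suc i)) = N (Suc i)"
  using chief_factor_cover_or_avoid[OF fin p N(3)[OF assms(2)] assms(3) M T subgroup.subset[OF K(1)] K(2)]
    assms(1) unfolding K_invariant_def by blast

lemma v_covered:
  assumes S: "K_invariant S" and i: "i \<in> covered S"
  shows "v (S \<inter> N (Suc i)) = v (S \<inter> N i) + (v (N (Suc i)) - v (N i))"
proof -
  have sub: "subgroup S G" and ir: "i < r" using assms by (auto simp: K_invariant_def covered_def)
  note less = covered_imp_p_factor[OF sub i]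
  show ?thesis
    using K_invariant_cover_or_avoid[OF S ir less] v_set_mult_Int[OF sub ir] i less by (auto simp: covered_def)
qed

lemma covered_mono:
  assumes S: "subgroup S G" and S': "K_invariant S'" and sub: "S \<subseteq> S'"
  shows "covered S \<subseteq> covered S'"
proof
  fix i assume i: "i \<in> covered S"
  then have ir: "i < r" by (simp add: covered_def)
  note less = covered_imp_p_factor[OF S i]
  have sub': "subgroup S' G" using S' by (simp add: K_invariant_def)
  have Ni: "N i \<lhd> G" using N_normal ir by simp
  have "N i <#> (S' \<inter> N (Suc i)) \<noteq> N i"
  proof
    assume eq: "N i <#> (S' \<inter> N (Suc i)) = N i"
    have "S' \<inter> N (Suc i) \<subseteq> N i"
      using subgroup_set_mult(3)[OF Ni subgroup_Int_N[OF sub', of "Suc i"]] ir eq by simp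
    then have "S \<inter> N (Suc i) = S \<inter> N i" using sub N_mono[OF ir] by blast
    then show False using i by (simp add: covered_def)
  qed
  then have "v (N (Suc i)) + v (S' \<inter> N i) = v (N i) + v (S' \<inter> N (Suc i))"
    using K_invariant_cover_or_avoid[OF S' ir less] v_set_mult_Int[OF sub' ir] by auto
  then show "i \<in> covered S'" using less ir by (simp add: covered_def)
qed

text \<open>Going up the series, the \<open>p\<close>-part of \<open>S \<inter> N i\<close> changes only at covered factors, and there by
  the full \<open>p\<close>-part of the factor. Hence the set of covered factors determines the \<open>p\<close>-part of the
  order of \<open>S\<close>.\<close>

lemma v_eq_sum_covered:
  assumes S: "K_invariant S"
  shows "v S = (\<Sum>i\<in>covered S. v (N (Suc i)) - v (N i))"
proof -
  have sub: "subgroup S G" using S by (simp add: K_invariant_def)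
  let ?d = "\<lambda>i. if i \<in> covered S then v (N (Suc i)) - v (N i) else 0"
  have "v (S \<inter> N j) = (\<Sum>i<j. ?d i)" if "j \<le> r" for j
    using that
  proof (induction j)
    case 0
    have "S \<inter> N 0 = {\<one>}" using N(1) subgroup.one_closed[OF sub] by auto
    then show ?case by simp
  next
    case (Suc j)
    have "v (S \<inter> N (Suc j)) = v (S \<inter> N j) + ?d j"
    proof (cases "j \<in> covered S")
      case True
      then show ?thesis using v_covered[OF S] by simp
    next
      case False
      moreover have "v (S \<inter> N j) \<le> v (S \<inter> N (Suc j))"
        using Suc.prems N_mono[of j] by (intro v_mono subgroup_Int_N[OF sub]) auto
      ultimately show ?thesis using Suc.prems by (simp add: covered_def)
    qed
    then show ?case using Suc by simp
  qed
  from this[of r] have "v S = (\<Sum>i<r. ?d i)"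
    using N(2) subgroup.subset[OF sub] by (simp add: Int_absorb2)
  also have "\<dots> = (\<Sum>i\<in>covered S. v (N (Suc i)) - v (N i))"
    by (rule sum.mono_neutral_cong_right) (auto simp: covered_def)
  finally show ?thesis .
qed

text \<open>This turns a growing \<open>p\<close>-part along a chain of subgroups into a count of chief factors.\<close>

lemma card_covered_less:
  assumes "K_invariant S" "K_invariant S'" "S \<subseteq> S'" "v S < v S'"
  shows "card (covered S) < card (covered S')"
proof (rule psubset_card_mono[OF finite_covered])
  have "covered S \<noteq> covered S'" using assms v_eq_sum_covered by fastforce
  then show "covered S \<subset> covered S'"
    using covered_mono[of S S'] assms by (auto simp: K_invariant_def)
qed

lemma K_invariant_supergroup:
  assumes "subgroup J G" "K \<subseteq> J"
  shows "K_invariant J"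
  using assms subgroup.m_closed[OF assms(1)] subgroup.m_inv_closed[OF assms(1)]
  by (auto simp: K_invariant_def)

text \<open>By maximality \<open>H N i\<close> is \<open>H\<close> or \<open>G\<close> for every \<open>i\<close>. Where the product does not change from
  \<open>i\<close> to \<open>i + 1\<close>, the factor has the same \<open>p\<close>-part in \<open>H\<close> as in \<open>G\<close>; and it changes at most
  once.\<close>

lemma card_covered_maximal_subgroup:
  assumes H: "maximal_subgroup H G"
  shows "card (covered (carrier G)) \<le> card (covered H) + 1"
proof -
  have sub: "subgroup H G" and max: "\<And>J. subgroup J G \<Longrightarrow> H \<subseteq> J \<Longrightarrow> J = H \<or> J = carrier G"
    using H by (auto simp: maximal_subgroup_def)
  have mono: "N i \<subseteq> N j" if "i \<le> j" "j \<le> r" for i j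
    using that by (induction j rule: dec_induct) (use N_mono in \<open>auto simp: Suc_le_eq\<close>)
  have edge: "N i \<subseteq> H \<and> \<not> N (Suc i) \<subseteq> H" if i: "i \<in> covered (carrier G) - covered H" for i
  proof -
    have ir: "i < r" using i by (simp add: covered_def)
    then have less: "v (N i) < v (N (Suc i))"
      using i carrier_Int_N[of i] carrier_Int_N[of "Suc i"] by (simp add: covered_def)
    have eq: "v (H \<inter> N i) = v (H \<inter> N (Suc i))"
    proof (rule antisym)
      show "v (H \<inter> N i) \<le> v (H \<inter> N (Suc i))"
        using ir N_mono[OF ir] by (intro v_mono subgroup_Int_N[OF sub]) auto
    qed (use i ir in \<open>simp add: covered_def\<close>)
    have "\<not> N (Suc i) \<subseteq> H"
    proof
      assume "N (Suc i) \<subseteq> H"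
      then have "H \<inter> N (Suc i) = N (Suc i)" "H \<inter> N i = N i" using N_mono[OF ir] by auto
      then show False using eq less by simp
    qed
    moreover have "N i \<subseteq> H"
    proof (rule ccontr)
      assume nsub: "\<not> N i \<subseteq> H"
      have full: "card (carrier G) * card (H \<inter> N j) = card (N j) * card H" if j: "j \<le> r" "N i \<subseteq> N j" for j
      proof -
        note * = subgroup_set_mult[OF N_normal[OF j(1)] sub]
        have "N j <#> H \<noteq> H" using *(2) nsub j(2) by blast
        then have "N j <#> H = carrier G" using max[OF *(1) *(3)] by blast
        then show ?thesis using card_set_mult[OF N_normal[OF j(1)] sub] by (simp add: Int_commute)
      qed
      have vfull: "v (carrier G) + v (H \<inter> N j) = v (N j) + v H" if j: "j \<le> r" "N i \<subseteq> N j" for j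
      proof -
        have "multiplicity p (card (carrier G) * card (H \<inter> N j)) = multiplicity p (card (N j) * card H)"
          using full[OF j] by simp
        moreover have "card (carrier G) > 0" "card (H \<inter> N j) > 0" "card (N j) > 0" "card H > 0"
          using card_pos subgroup_self subgroup_Int_N[OF sub j(1)] normal_imp_subgroup[OF N_normal[OF j(1)]] sub by auto
        ultimately show ?thesis using p by (simp add: prime_elem_multiplicity_mult_distrib)
      qed
      show False using vfull[of i] vfull[of "Suc i"] ir N_mono[OF ir] eq less by simp
    qed
    ultimately show ?thesis by blast
  qed
  have "i = j" if ij: "i \<in> covered (carrier G) - covered H" "j \<in> covered (carrier G) - covered H" for i j
  proof (rule ccontr)
    assume "i \<noteq> j"
    moreover have "i < r" "j < r" using ij by (auto simp: covered_def)
    ultimately have "N (Suc i) \<subseteq> N j \<or> N (Suc j) \<subseteq> N i"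
      using mono[of "Suc i" j] mono[of "Suc j" i] by linarith
    then show False using edge[OF ij(1)] edge[OF ij(2)] by blast
  qed
  then have "card (covered (carrier G) - covered H) \<le> 1"
    using finite_covered by (simp add: card_le_Suc0_iff_eq)
  moreover have "card (covered (carrier G)) - card (covered H) \<le> card (covered (carrier G) - covered H)"
    by (rule diff_card_le_card_Diff[OF finite_covered])
  ultimately show ?thesis by linarith
qed

text \<open>The isomorphism carries the subgroups \<open>H \<inter> N i\<close>, which are normal in \<open>H\<close>, to a chain of
  normal subgroups of \<open>K\<close>, with the same orders. The subgroups in this chain therefore cover or avoid
  every chief factor of order divisible by \<open>p\<close>, and each time the \<open>p\<close>-part of the order grows a
  further factor gets covered.\<close>

lemma card_covered_iso:
  assumes H: "subgroup H G" and iso: "G\<lparr>carrier := H\<rparr> \<cong> G\<lparr>carrier := K\<rparr>"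
  shows "card (covered H) \<le> card (covered K)"
proof -
  let ?H = "G\<lparr>carrier := H\<rparr>" and ?K = "G\<lparr>carrier := K\<rparr>"
  obtain \<phi> where \<phi>: "\<phi> \<in> iso ?H ?K" using iso by (auto simp: is_iso_def)
  then have bij: "bij_betw \<phi> H K" by (simp add: iso_def)
  define L where "L i = \<phi> ` (H \<inter> N i)" for i
  have L_K_invariant: "K_invariant (L i)" if i: "i \<le> r" for i
  proof -
    have "H \<inter> N i \<lhd> ?H"
      using normal_Int_subgroup[OF H N_normal[OF i]] by (simp add: Int_commute)
    then have L: "L i \<lhd> ?K"
      unfolding L_def using iso_normal_subgroup[OF \<phi>] subgroup_imp_group H K(1) by blast
    have "subgroup (L i) G" using incl_subgroup[OF K(1)] normal_imp_subgroup[OF L] by blast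
    moreover have "x \<otimes> s \<otimes> inv x \<in> L i" if "x \<in> K" "s \<in> L i" for x s
      using normal.inv_op_closed2[OF L, of x s] that m_inv_consistent[OF K(1)] by simp
    ultimately show ?thesis by (simp add: K_invariant_def)
  qed
  have v_L: "v (L i) = v (H \<inter> N i)" for i
    unfolding L_def using bij by (metis bij_betw_def card_image inf_le1 inj_on_subset)
  have "card (covered H \<inter> {..<j}) \<le> card (covered (L j))" if "j \<le> r" for j
    using that
  proof (induction j)
    case (Suc j)
    have j: "j < r" and IH: "card (covered H \<inter> {..<j}) \<le> card (covered (L j))" using Suc by auto
    have st: "K_invariant (L j)" "K_invariant (L (Suc j))" using L_K_invariant j by auto
    have sub: "L j \<subseteq> L (Suc j)" unfolding L_def using N_mono[OF j] by blast
    show ?case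
    proof (cases "j \<in> covered H")
      case True
      then have "v (L j) < v (L (Suc j))" using v_L by (simp add: covered_def)
      then have "card (covered (L j)) < card (covered (L (Suc j)))"
        by (rule card_covered_less[OF st sub])
      moreover have "covered H \<inter> {..<Suc j} = insert j (covered H \<inter> {..<j})" using True by auto
      ultimately show ?thesis using IH by simp
    next
      case False
      then have "covered H \<inter> {..<Suc j} = covered H \<inter> {..<j}" by (auto simp: less_Suc_eq)
      moreover have "card (covered (L j)) \<le> card (covered (L (Suc j)))"
        using st sub by (intro card_mono[OF finite_covered] covered_mono) (auto simp: K_invariant_def)
      ultimately show ?thesis using IH by simp
    qed
  qed simp
  from this[of r] have "card (covered H \<inter> {..<r}) \<le> card (covered (L r))" by simp
  moreover have "covered H \<inter> {..<r} = covered H" by (auto simp: covered_def)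
  moreover have "L r = K"
    unfolding L_def using N(2) subgroup.subset[OF H] bij by (simp add: Int_absorb2 bij_betw_def)
  ultimately show ?thesis by simp
qed

end

section \<open>Maximality of the isomorphic subgroup\<close>

lemma multiplicity_less_if_p_power_index:
  fixes a :: nat
  assumes "Factorial_Ring.prime p" "b = a * c" "b > a" "a > 0" "c dvd p ^ n"
  shows "multiplicity p a < multiplicity p b"
proof -
  obtain j where j: "c = p ^ j" using assms(1,5) divides_primepow_nat by blast
  then have "j > 0" using assms(2,3) by (cases j) auto
  then show ?thesis
    using assms(1,2,4) j by (simp add: prime_elem_multiplicity_mult_distrib)
qed

theorem theorem1p5:
  fixes G :: "('a, 'b) monoid_scheme" (structure)
    and H K :: "'a set" and p n :: nat
  assumes "group G" and "finite (carrier G)" and "solvable G"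
    and "maximal_subgroup H G" and "subgroup K G"
    and "G\<lparr>carrier := H\<rparr> \<cong> G\<lparr>carrier := K\<rparr>"
    and "Factorial_Ring.prime p" and "n > 0" and "card (rcosets H) = p ^ n"
    and "p_length p G \<le> 1"
  shows "maximal_subgroup K G"
proof -
  interpret group G by fact
  note fin = assms(2) and p = assms(7) and subK = \<open>subgroup K G\<close>
  have H: "subgroup H G" "H \<noteq> carrier G" using assms(4) by (auto simp: maximal_subgroup_def)
  have "card H = card K" using iso_same_card[OF assms(6)] by simp
  then have cG: "card (carrier G) = card K * p ^ n"
    using lagrange[OF H(1)] assms(9) by (simp add: order_def mult.commute)
  obtain M T k c where M: "M \<lhd> G" "coprime p (card M)"
    and T: "T \<lhd> G" "M \<subseteq> T" "card T = card M * p ^ k"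
    and GT: "card (carrier G) = card T * c" "coprime p c"
    using p_length_le_1_imp_pprime_p_pprime_series[OF fin p assms(3,10)] by metis
  note TK = subgroup_set_mult[OF T(1) subK]
  have pos: "card S > 0" if "subgroup S G" for S
    using subgroup.finite_imp_card_positive[OF that fin] .
  \<comment> \<open>The index of \<open>TK\<close> divides that of \<open>K\<close>, a power of \<open>p\<close>, and that of \<open>T\<close>, prime to \<open>p\<close>.\<close>
  have TK_eq: "T <#> K = carrier G"
  proof (rule card_subset_eq[OF fin subgroup.subset[OF TK(1)]])
    obtain d where d: "card (carrier G) = card (T <#> K) * d"
      using card_subgroup_dvd[OF TK(1) subgroup_self subgroup.subset[OF TK(1)]] by blast
    obtain e where "card (T <#> K) = card K * e" using card_subgroup_dvd[OF subK TK(1,3)] by blast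
    then have "e * d = p ^ n" using d cG pos[OF subK] by simp
    then have "d dvd p ^ n" by (metis dvd_triv_right)
    moreover obtain f where "card (T <#> K) = card T * f"
      using card_subgroup_dvd[OF normal_imp_subgroup[OF T(1)] TK(1,2)] by blast
    then have "f * d = c" using d GT pos[OF normal_imp_subgroup[OF T(1)]] by simp
    then have "d dvd c" by (metis dvd_triv_right)
    ultimately have "d = 1"
      using GT(2) coprime_common_divisor_nat[of "p ^ n" c d] by simp
    then show "card (T <#> K) = card (carrier G)" using d by simp
  qed
  obtain N r where N: "N 0 = {\<one>}" "N r = carrier G" "\<And>i. i < r \<Longrightarrow> chief_factor (N i) (N (Suc i))"
    using exists_chief_series_above[OF fin one_is_normal] by blast
  interpret p_length_one_chief_series G p k M T K N r
    by (simp add: p_length_one_chief_series_def p_length_one_chief_series_axioms_def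
        is_group fin p M T subK TK_eq N)
  have le: "card (covered (carrier G)) \<le> card (covered K) + 1"
    using card_covered_maximal_subgroup[OF assms(4)] card_covered_iso[OF H(1) assms(6)] by linarith
  show ?thesis unfolding maximal_subgroup_def
  proof (intro conjI allI impI)
    show "subgroup K G" by fact
    show "K \<noteq> carrier G"
      using cG pos[OF subK] one_less_power[OF prime_gt_1_nat[OF p] assms(8)] by auto
    fix J assume J: "subgroup J G \<and> K \<subseteq> J"
    show "J = K \<or> J = carrier G"
    \<comment> \<open>Otherwise \<open>K < J < G\<close> makes the covered set grow twice, but \<open>K\<close> misses at most one
      factor.\<close>
    proof (rule ccontr)
      assume ne: "\<not> (J = K \<or> J = carrier G)"
      have JG: "J \<subseteq> carrier G" using J subgroup.subset by blast
      obtain a where a: "card J = card K * a" using card_subgroup_dvd J subK by blast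
      obtain b where b: "card (carrier G) = card J * b" using card_subgroup_dvd[OF _ subgroup_self JG] J by blast
      have ab: "a * b = p ^ n" using a b cG pos[OF subK] by simp
      have "K \<subset> J" "J \<subset> carrier G" using ne J JG by auto
      then have less: "card K < card J" "card J < card (carrier G)"
        using fin JG finite_subset psubset_card_mono by metis+
      have "v K < v J"
        using multiplicity_less_if_p_power_index[OF p a less(1) pos[OF subK]] ab by (metis dvd_triv_left)
      moreover have "v J < v (carrier G)"
        using multiplicity_less_if_p_power_index[OF p b less(2)] pos J ab by (metis dvd_triv_right)
      moreover have "K_invariant K" "K_invariant J" "K_invariant (carrier G)"
        using K_invariant_supergroup subK J subgroup_self JG by auto
      ultimately have "card (covered K) < card (covered J)" "card (covered J) < card (covered (carrier G))"
        using card_covered_less J JG by auto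
      then show False using le by linarith
    qed
  qed
qed

end
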